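(* Let $\pi^*$ be a minimizer of $\min_{\pi\in(\Delta_{\mathcal A})^{\mathcal X\times N}}F(\mu^{\pi})$. Define $L:=\ell N$, where $\ell$ is the Lipschitz constant of $f_n$ with respect to $\|\cdot\|_1$ for all $n\in[N]$. Applying $K$ iterations of MD-CURL to this problem, with, for every $k$, learning rate $$\tau_k:=\frac1L\sqrt{\frac{2\,\Gamma(\mu^{\pi^*},\mu^0)}{K}},$$ gives the following convergence rate: $$\min_{0\le k\le K}F(\mu^{\pi^k})-F(\mu^{\pi^*})\le L\,\frac{\sqrt{2\,\Gamma(\mu^{\pi^*},\mu^0)}}{\sqrt K}.$$
   Context: Notation: $[s]=\{1,\dots,s\}$; $\Delta_S$ is the probability simplex over a finite set $S$; $0\log 0=0$. $\mathcal X$ and $\mathcal A$ are finite state and action sets, $N\ge1$ is the episode length, $p=(p_n)_{n\in[N]}$ is a (known) transition kernel, $p_n(x'|x,a)$ being the probability of being in $x'$ at step $n$ given $(x,a)$ at step $n-1$. $\mu_0\in\Delta_{\mathcal X\times\mathcal A}$ is a fixed initial state-action distribution. A policy is $\pi=(\pi_n)_{n\in[N]}\in(\Delta_{\mathcal A})^{\mathcal X\times N}$; it induces $\mu^\pi=(\mu_n^\pi)$ by $\mu_0^\pi=\mu_0$ and $\mu_n^\pi(x',a')=\sum_{x,a}\mu_{n-1}^\pi(x,a)p_n(x'|x,a)\pi_n(a'|x')$. $\mathcal M_{\mu_0}$ is the set of $\mu\in(\Delta_{\mathcal X\times\mathcal A})^N$ with $\sum_{a'}\mu_n(x',a')=\sum_{x,a}p_n(x'|x,a)\mu_{n-1}(x,a)$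 for all $x'$ and $n\in[N]$. Each $\mu\in\mathcal M_{\mu_0}$ corresponds to the policy $\pi_n(a|x)=\mu_n(x,a)/\sum_{a'}\mu_n(x,a')$ if the denominator is nonzero, $1/|\mathcal A|$ otherwise; $\mathcal M^*_{\mu_0}$ is the subset whose policies satisfy $\pi_n(a|x)\neq0$ for all $n,x,a$. For $\mu^\pi\in\mathcal M_{\mu_0}$, $\mu^{\pi'}\in\mathcal M_{\mu_0}^*$: $\Gamma(\mu^\pi,\mu^{\pi'}):=\sum_{n=1}^N\sum_{x,a}\mu_n^\pi(x,a)\log\frac{\pi_n(a|x)}{\pi_n'(a|x)}$. $F(\mu)=\sum_{n=1}^Nf_n(\mu_n)$ with each $f_n:\Delta_{\mathcal X\times\mathcal A}\to\mathbb R$ convex, differentiable, and $\ell$-Lipschitz with respect to $\|\cdot\|_1$. MD-CURL: start from a policy $\pi^0$ with $\mu^0:=\mu^{\pi^0}\in\mathcal M_{\mu_0}^*$. For $k=0,\dots,K-1$: set $\mu^k=\mu^{\pi^k}$; compute $\tilde Q_N^k(x,a)=-\nabla f_N(\mu_N^k)(x,a)$ and, backward for $n=N-1,\dots,1$, $$\tilde Q_n^k(x,a)=\max_{\pi_{n+1}\in(\Delta_{\mathcal A})^{\mathcal X}}\Big\{-\nabla f_n(\mu_n^k)(x,a)+\sum_{x'}p_{n+1}(x'|x,a)\sum_{a'}\pi_{n+1}(a'|x')\Big[-\tfrac1{\tau_k}\log\tfrac{\pi_{n+1}(a'|x')}{\pi^k_{n+1}(a'|x')}+\tilde Q_{n+1}^k(x',a')\Big]\Big\};$$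 and set, for all $n\in[N]$, $\pi_n^{k+1}(a|x)=\pi_n^k(a|x)e^{\tau_k\tilde Q_n^k(x,a)}\big/\sum_{a'}\pi_n^k(a'|x)e^{\tau_k\tilde Q_n^k(x,a')}$. Equivalently, $\mu^{k+1}\in\arg\min_{\mu\in\mathcal M_{\mu_0}}\{\sum_{n}\langle\nabla f_n(\mu_n^k),\mu_n\rangle+\frac1{\tau_k}\Gamma(\mu,\mu^k)\}$. *)

theory Defs
  imports "HOL-Analysis.Analysis"
begin

text \<open>
  The finite nonempty state and action sets are the types \<open>'x\<close> and \<open>'a\<close>.
  Everything indexed by a time step is a function on \<open>nat\<close> of which only the values at
  \<open>{1..N}\<close> (for occupancy measures \<open>{0..N}\<close>) matter.
\<close>

type_synonym ('x, 'a) kernel = "nat \<Rightarrow> 'x \<Rightarrow> 'a \<Rightarrow> real ^ 'x"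
type_synonym ('x, 'a) policy = "nat \<Rightarrow> 'x \<Rightarrow> real ^ 'a"
type_synonym ('x, 'a) occupancy = "nat \<Rightarrow> real ^ ('x \<times> 'a)"

definition prob_simplex :: "(real ^ 's) set" where
  "prob_simplex = {v. (\<forall>i. 0 \<le> v $ i) \<and> (\<Sum>i\<in>UNIV. v $ i) = 1}"

definition norm1 :: "real ^ 's \<Rightarrow> real" where
  "norm1 v = (\<Sum>i\<in>UNIV. \<bar>v $ i\<bar>)"

definition lipschitz1_on :: "real \<Rightarrow> (real ^ 's) set \<Rightarrow> (real ^ 's \<Rightarrow> real) \<Rightarrow> bool" where
  "lipschitz1_on l S f \<longleftrightarrow> 0 \<le> l \<and> (\<forall>u\<in>S. \<forall>v\<in>S. \<bar>f u - f v\<bar> \<le> l * norm1 (u - v))"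

definition transition_kernel :: "nat \<Rightarrow> ('x::finite, 'a::finite) kernel \<Rightarrow> bool" where
  "transition_kernel N p \<longleftrightarrow> (\<forall>n\<in>{1..N}. \<forall>x a. p n x a \<in> prob_simplex)"

definition policies :: "nat \<Rightarrow> ('x::finite, 'a::finite) policy set" where
  "policies N = {\<pi>. \<forall>n\<in>{1..N}. \<forall>x. \<pi> n x \<in> prob_simplex}"

primrec occ :: "('x::finite, 'a::finite) kernel \<Rightarrow> real ^ ('x \<times> 'a) \<Rightarrow> ('x, 'a) policy
    \<Rightarrow> ('x, 'a) occupancy" where
  "occ p \<mu>0 \<pi> 0 = \<mu>0"
| "occ p \<mu>0 \<pi> (Suc n) = (\<chi> s. case s of (x', a') \<Rightarrow>
     \<Sum>(x, a)\<in>UNIV. occ p \<mu>0 \<pi> n $ (x, a) * p (Suc n) x a $ x' * \<pi> (Suc n) x' $ a')"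

definition occ_set :: "nat \<Rightarrow> ('x::finite, 'a::finite) kernel \<Rightarrow> real ^ ('x \<times> 'a)
    \<Rightarrow> ('x, 'a) occupancy set" where
  "occ_set N p \<mu>0 = {\<mu>. \<mu> 0 = \<mu>0 \<and> (\<forall>n\<in>{1..N}. \<mu> n \<in> prob_simplex \<and>
     (\<forall>x'. (\<Sum>a'\<in>UNIV. \<mu> n $ (x', a')) =
           (\<Sum>(x, a)\<in>UNIV. p n x a $ x' * \<mu> (n - 1) $ (x, a))))}"

definition policy_of :: "('x::finite, 'a::finite) occupancy \<Rightarrow> ('x, 'a) policy" where
  "policy_of \<mu> n x = (\<chi> a.
     if (\<Sum>a'\<in>UNIV. \<mu> n $ (x, a')) \<noteq> 0
     then \<mu> n $ (x, a) / (\<Sum>a'\<in>UNIV. \<mu> n $ (x, a'))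
     else 1 / real CARD('a))"

definition occ_set_pos :: "nat \<Rightarrow> ('x::finite, 'a::finite) kernel \<Rightarrow> real ^ ('x \<times> 'a)
    \<Rightarrow> ('x, 'a) occupancy set" where
  "occ_set_pos N p \<mu>0 =
     {\<mu> \<in> occ_set N p \<mu>0. \<forall>n\<in>{1..N}. \<forall>x a. policy_of \<mu> n x $ a \<noteq> 0}"

text \<open>
  For \<open>\<mu> = occ p \<mu>0 \<pi>\<close> the policy \<open>policy_of \<mu>\<close> agrees with \<open>\<pi>\<close> at every state of positive
  mass. When \<open>\<mu>'\<close> is in \<open>occ_set_pos\<close>, states without mass under \<open>\<mu>'\<close> have none under \<open>\<mu>\<close>
  either and get weight zero below, so the divergence is the same whether it is computed from
  the inducing policies or from \<open>policy_of\<close>.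
\<close>

definition Gam :: "nat \<Rightarrow> ('x::finite, 'a::finite) occupancy \<Rightarrow> ('x, 'a) occupancy \<Rightarrow> real" where
  "Gam N \<mu> \<mu>' = (\<Sum>n=1..N. \<Sum>(x, a)\<in>UNIV.
     \<mu> n $ (x, a) * ln (policy_of \<mu> n x $ a / policy_of \<mu>' n x $ a))"

definition objective :: "nat \<Rightarrow> (nat \<Rightarrow> real ^ ('x \<times> 'a) \<Rightarrow> real)
    \<Rightarrow> ('x::finite, 'a::finite) occupancy \<Rightarrow> real" where
  "objective N f \<mu> = (\<Sum>n=1..N. f n (\<mu> n))"

text \<open>
  \<open>G\<close> is a gradient map of \<open>f\<close> on the simplex. As the simplex has codimension one, the gradient
  is determined only up to adding a multiple of the all-ones vector; such a shift changes each
  \<open>Q\<close> function of the algorithm by a constant and leaves the policies it produces unchanged.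
\<close>

definition simplex_gradient :: "(real ^ 's::finite \<Rightarrow> real) \<Rightarrow> (real ^ 's \<Rightarrow> real ^ 's) \<Rightarrow> bool" where
  "simplex_gradient f G \<longleftrightarrow>
     (\<forall>v\<in>prob_simplex. (f has_derivative (\<lambda>h. G v \<bullet> h)) (at v within prob_simplex))"

text \<open>
  The regularised state-action value function at policy \<open>\<pi>\<close>, occupancy measure \<open>\<mu>\<close> and learning
  rate \<open>t\<close>; \<open>G n\<close> is the gradient of the \<open>n\<close>-th cost. The supremum is a maximum, since the
  bracket is continuous in \<open>q\<close> and \<open>q\<close> ranges over a compact set. The convention
  \<open>0 log 0 = 0\<close> is that of \<open>ln\<close>; the junk value at \<open>\<pi> (Suc n) x' $ a' = 0\<close> can only
  occur, when \<open>\<mu>\<close> is in \<open>occ_set_pos\<close>, at states \<open>x'\<close> that have probability zero at step \<open>Suc n\<close>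
  under every policy.
\<close>

function md_Q :: "nat \<Rightarrow> ('x::finite, 'a::finite) kernel \<Rightarrow> (nat \<Rightarrow> real ^ ('x \<times> 'a) \<Rightarrow> real ^ ('x \<times> 'a))
    \<Rightarrow> real \<Rightarrow> ('x, 'a) policy \<Rightarrow> ('x, 'a) occupancy \<Rightarrow> nat \<Rightarrow> 'x \<Rightarrow> 'a \<Rightarrow> real" where
  "md_Q N p G t \<pi> \<mu> n x a =
     (if n < N then
        (SUP q \<in> {q. \<forall>x'. q x' \<in> prob_simplex}.
           - G n (\<mu> n) $ (x, a) +
           (\<Sum>x'\<in>UNIV. p (Suc n) x a $ x' *
              (\<Sum>a'\<in>UNIV. q x' $ a' *
                 (- (1 / t) * ln (q x' $ a' / \<pi> (Suc n) x' $ a')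
                  + md_Q N p G t \<pi> \<mu> (Suc n) x' a'))))
      else - G N (\<mu> N) $ (x, a))"
  by pat_completeness auto
termination by (relation "Wellfounded.measure (\<lambda>(N, p, G, t, \<pi>, \<mu>, n, x, a). N - n)") auto

declare md_Q.simps [simp del]

primrec md_curl :: "nat \<Rightarrow> ('x::finite, 'a::finite) kernel \<Rightarrow> real ^ ('x \<times> 'a)
    \<Rightarrow> (nat \<Rightarrow> real ^ ('x \<times> 'a) \<Rightarrow> real ^ ('x \<times> 'a)) \<Rightarrow> (nat \<Rightarrow> real) \<Rightarrow> ('x, 'a) policy
    \<Rightarrow> nat \<Rightarrow> ('x, 'a) policy" where
  "md_curl N p \<mu>0 G \<tau> \<pi>0 0 = \<pi>0"
| "md_curl N p \<mu>0 G \<tau> \<pi>0 (Suc k) =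
     (let \<pi> = md_curl N p \<mu>0 G \<tau> \<pi>0 k;
          Q = md_Q N p G (\<tau> k) \<pi> (occ p \<mu>0 \<pi>)
      in (\<lambda>n x. \<chi> a. \<pi> n x $ a * exp (\<tau> k * Q n x a) /
                     (\<Sum>a'\<in>UNIV. \<pi> n x $ a' * exp (\<tau> k * Q n x a'))))"

end

theory Submission
  imports Defs "HOL-Probability.Hoeffding"
begin

text \<open>
  Write \<open>\<pi>'\<close> for the policy produced from \<open>\<pi>\<close> by one step with learning rate \<open>t\<close>. On the states that
  matter, \<open>ln (\<pi>' / \<pi>)\<close> is \<open>t\<close> times the soft advantage, so the Bellman recursion telescopes along the
  trajectory of any policy \<open>\<nu>\<close>: up to a constant independent of \<open>\<nu>\<close>, \<open>t\<close> times the linearised cost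
  of \<open>\<nu>\<close> is minus the \<open>\<nu>\<close>-expectation of \<open>ln (\<pi>' / \<pi>)\<close>. Comparing the optimal policy with \<open>\<pi>'\<close>
  turns the optimality gap of \<open>\<pi>'\<close> in the linearised cost into a difference of divergences minus
  \<open>\<Gamma>(\<pi>', \<pi>)\<close>. The remaining term, the change of the linearised cost from \<open>\<pi>\<close> to \<open>\<pi>'\<close>, is at most
  \<open>l\<close> times an \<open>L1\<close> distance, and Pinsker's inequality in the form
  \<open>s * dist \<le> \<Gamma>(\<pi>', \<pi>) + s\<^sup>2 / 2\<close> bounds it, absorbing \<open>\<Gamma>(\<pi>', \<pi>)\<close>. Summing over the iterations gives
  the rate.
\<close>

section \<open>Sums over pairs and the probability simplex\<close>

lemma sum_UNIV_prod:
  fixes F :: "'x::finite \<times> 'a::finite \<Rightarrow> real"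
  shows "(\<Sum>s\<in>UNIV. F s) = (\<Sum>x\<in>UNIV. \<Sum>a\<in>UNIV. F (x, a))"
  by (simp add: sum.cartesian_product flip: UNIV_Times_UNIV)

lemma prob_simplexD:
  assumes "v \<in> prob_simplex"
  shows "0 \<le> v $ i" and "(\<Sum>i\<in>UNIV. v $ i) = 1"
  using assms by (auto simp: prob_simplex_def)

lemma convex_prob_simplex: "convex (prob_simplex :: (real ^ 's::finite) set)"
  by (auto simp: convex_def prob_simplex_def sum.distrib simp flip: sum_distrib_left)

lemma prob_simplex_nonempty: "\<exists>q :: real ^ 's::finite. q \<in> prob_simplex"
  by (rule exI[of _ "\<chi> i. 1 / real CARD('s)"]) (simp add: prob_simplex_def)

lemma sum_simplex_pos:
  fixes v :: "real ^ 's::finite"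
  assumes "v \<in> prob_simplex" and "\<And>i. 0 < w i"
  shows "0 < (\<Sum>i\<in>UNIV. v $ i * w i)"
proof -
  obtain i where "v $ i \<noteq> 0"
    using prob_simplexD(2)[OF assms(1)] by (metis sum.neutral zero_neq_one)
  then have "0 < v $ i * w i"
    using prob_simplexD(1)[OF assms(1), of i] assms(2)[of i] by simp
  moreover have "v $ i * w i \<le> (\<Sum>i\<in>UNIV. v $ i * w i)"
    using prob_simplexD(1)[OF assms(1)] assms(2) by (intro member_le_sum) (auto simp: less_imp_le)
  ultimately show ?thesis by linarith
qed

section \<open>Exponential moments on a finite probability space\<close>

lemma exp_jensen:
  fixes v :: "real ^ 's::finite"
  assumes "v \<in> prob_simplex"
  shows "exp (\<Sum>i\<in>UNIV. v $ i * h i) \<le> (\<Sum>i\<in>UNIV. v $ i * exp (h i))"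
proof -
  have "convex_on UNIV (\<lambda>x::real. exp (1 * x))"
    by (rule convex_on_exp) simp
  from convex_on_sum[OF _ _ this, of UNIV "\<lambda>i. v $ i" h] show ?thesis
    using prob_simplexD[OF assms] by simp
qed

text \<open>The inequality \<open>ln y \<le> y - 1\<close> at y = r e^h / (q Z), weighted by q,
  bounds the gap termwise; the right-hand sides sum to zero because r e^h / Z and q both have total
  mass 1. With h = 0 and r of mass 1 this is nonnegativity of relative entropy; with h = t Q it
  bounds the regularised maximisation in \<open>md_Q\<close>.\<close>

lemma gibbs_variational:
  fixes q r :: "real ^ 's::finite"
  assumes q: "q \<in> prob_simplex" and r: "\<And>i. 0 < r $ i"
  shows "(\<Sum>i\<in>UNIV. q $ i * (h i - ln (q $ i / r $ i))) \<le> ln (\<Sum>i\<in>UNIV. r $ i * exp (h i))"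
proof -
  define Z where "Z = (\<Sum>i\<in>UNIV. r $ i * exp (h i))"
  have Z: "0 < Z"
    unfolding Z_def using r by (intro sum_pos) auto
  have "q $ i * (h i - ln (q $ i / r $ i) - ln Z) \<le> r $ i * exp (h i) / Z - q $ i" for i
  proof (cases "q $ i = 0")
    case True
    then show ?thesis using r[of i] Z by simp
  next
    case False
    then have qi: "0 < q $ i" using prob_simplexD(1)[OF q, of i] by simp
    have "h i - ln (q $ i / r $ i) - ln Z = ln (r $ i * exp (h i) / (q $ i * Z))"
      using qi r[of i] Z by (simp add: ln_div ln_mult)
    also have "\<dots> \<le> r $ i * exp (h i) / (q $ i * Z) - 1"
      using qi r[of i] Z by (intro ln_le_minus_one) simp
    finally have "q $ i * (h i - ln (q $ i / r $ i) - ln Z)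
        \<le> q $ i * (r $ i * exp (h i) / (q $ i * Z) - 1)"
      using qi by simp
    also have "\<dots> = r $ i * exp (h i) / Z - q $ i"
      using qi Z by (simp add: field_simps)
    finally show ?thesis .
  qed
  then have "(\<Sum>i\<in>UNIV. q $ i * (h i - ln (q $ i / r $ i) - ln Z))
      \<le> (\<Sum>i\<in>UNIV. r $ i * exp (h i) / Z - q $ i)"
    by (intro sum_mono)
  also have "\<dots> = 0"
    using Z prob_simplexD(2)[OF q]
    by (simp add: sum_subtractf Z_def flip: sum_divide_distrib)
  also have "(\<Sum>i\<in>UNIV. q $ i * (h i - ln (q $ i / r $ i) - ln Z))
      = (\<Sum>i\<in>UNIV. q $ i * (h i - ln (q $ i / r $ i))) - ln Z"
    using prob_simplexD(2)[OF q]
    by (simp add: right_diff_distrib sum_subtractf flip: sum_distrib_right)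
  finally show ?thesis by (simp add: Z_def)
qed

text \<open>The equality case of Gibbs' inequality: for the Gibbs vector each bracket is the
  constant \<open>ln Z\<close>. It provides the maximiser for the supremum in
  \<open>md_Q\<close>.\<close>

lemma gibbs_attained:
  fixes r :: "real ^ 's::finite" and h :: "'s \<Rightarrow> real"
  assumes r: "\<And>i. 0 < r $ i"
  defines "Z \<equiv> \<Sum>i\<in>UNIV. r $ i * exp (h i)"
  defines "q \<equiv> \<chi> i. r $ i * exp (h i) / Z"
  shows "(\<Sum>i\<in>UNIV. q $ i * (h i - ln (q $ i / r $ i))) = ln Z"
    and "q \<in> prob_simplex"
proof -
  have Z: "0 < Z"
    unfolding Z_def using r by (intro sum_pos) auto
  have sum1: "(\<Sum>i\<in>UNIV. q $ i) = 1"
    using Z by (simp add: q_def Z_def flip: sum_divide_distrib)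
  show "q \<in> prob_simplex"
    using Z r sum1 by (auto simp: prob_simplex_def q_def less_imp_le)
  have "h i - ln (q $ i / r $ i) = ln Z" for i
    using Z r[of i] by (simp add: q_def ln_div ln_mult)
  then have "(\<Sum>i\<in>UNIV. q $ i * (h i - ln (q $ i / r $ i))) = (\<Sum>i\<in>UNIV. q $ i * ln Z)"
    by simp
  also have "\<dots> = ln Z"
    by (simp add: sum1 flip: sum_distrib_right)
  finally show "(\<Sum>i\<in>UNIV. q $ i * (h i - ln (q $ i / r $ i))) = ln Z" .
qed

text \<open>Under \<open>v\<close> the sign \<open>e\<close> is twice a Bernoulli variable minus 1,
  so Hoeffding's lemma at 2s contributes (2s)^2 / 8 = s^2 / 2.\<close>

lemma sign_mgf_bound:
  fixes v :: "real ^ 's::finite"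
  assumes v: "v \<in> prob_simplex" and e: "\<And>i. e i = 1 \<or> e i = -1" and s: "0 \<le> s"
  shows "ln (\<Sum>i\<in>UNIV. v $ i * exp (s * e i)) \<le> s * (\<Sum>i\<in>UNIV. v $ i * e i) + s\<^sup>2 / 2"
proof -
  \<comment> \<open>\<open>m\<close> is the probability that \<open>e\<close> equals 1.\<close>
  define m where "m = (1 + (\<Sum>i\<in>UNIV. v $ i * e i)) / 2"
  have e_alt: "v $ i * (1 + e i) / 2 \<ge> 0" for i
    using e[of i] prob_simplexD(1)[OF v, of i] by auto
  have m_alt: "m = (\<Sum>i\<in>UNIV. v $ i * (1 + e i) / 2)"
    unfolding m_def using prob_simplexD(2)[OF v]
    by (simp add: sum.distrib distrib_left flip: sum_divide_distrib)
  have m: "0 \<le> m"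
    unfolding m_alt by (intro sum_nonneg) (use e_alt in auto)
  have pos: "0 < 1 + m * (exp (2 * s) - 1)"
    using m s by (intro add_pos_nonneg mult_nonneg_nonneg) auto
  have "v $ i * exp (s * e i)
      = exp (- s) * (v $ i + v $ i * (1 + e i) / 2 * (exp (2 * s) - 1))" for i
  proof -
    have "exp (- s) * exp (2 * s) = exp s"
      by (simp flip: exp_add)
    then have "exp (- s) * (exp (2 * s) - 1) = exp s - exp (- s)"
      by (simp add: algebra_simps)
    then have "exp (- s) * (v $ i + v $ i * (1 + e i) / 2 * (exp (2 * s) - 1))
        = exp (- s) * v $ i + v $ i * (1 + e i) / 2 * (exp s - exp (- s))"
      by (metis distrib_left mult.left_commute)
    also have "\<dots> = v $ i * exp (s * e i)"
      using e[of i] by (elim disjE) (simp_all add: algebra_simps)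
    finally show ?thesis ..
  qed
  then have "(\<Sum>i\<in>UNIV. v $ i * exp (s * e i))
      = exp (- s) * (\<Sum>i\<in>UNIV. v $ i + v $ i * (1 + e i) / 2 * (exp (2 * s) - 1))"
    by (simp only: sum_distrib_left)
  also have "\<dots> = exp (- s) * (1 + m * (exp (2 * s) - 1))"
    by (simp only: sum.distrib prob_simplexD(2)[OF v] m_alt flip: sum_distrib_right)
  finally have "ln (\<Sum>i\<in>UNIV. v $ i * exp (s * e i)) = - s + ln (1 + m * (exp (2 * s) - 1))"
    using pos by (simp add: ln_mult)
  also have "\<dots> \<le> - s + 2 * s * m + (2 * s)\<^sup>2 / 8"
    using Hoeffdings_lemma_aux[of "2 * s" m] m s by simp
  also have "\<dots> = s * (\<Sum>i\<in>UNIV. v $ i * e i) + s\<^sup>2 / 2"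
    by (simp add: m_def field_simps power2_eq_square)
  finally show ?thesis .
qed

section \<open>First-order inequalities on the simplex\<close>

text \<open>\<open>G\<close> represents a derivative only within the simplex, so it is composed with
  a segment that stays inside; this yields a one-sided limit at 0.\<close>

lemma simplex_gradient_limit:
  fixes f :: "real ^ 's::finite \<Rightarrow> real"
  assumes G: "simplex_gradient f G" and u: "u \<in> prob_simplex" and v: "v \<in> prob_simplex"
  shows "((\<lambda>t. (f (v + t *\<^sub>R (u - v)) - f v) / t) \<longlongrightarrow> G v \<bullet> (u - v)) (at 0 within {0..1})"
proof -
  let ?c = "\<lambda>t::real. v + t *\<^sub>R (u - v)"
  have c: "(?c has_derivative (\<lambda>t. t *\<^sub>R (u - v))) (at 0 within {0..1})"
    by (auto intro!: derivative_eq_intros)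
  have img: "?c ` {0..1} \<subseteq> prob_simplex"
  proof safe
    fix t :: real assume "t \<in> {0..1}"
    then have "(1 - t) *\<^sub>R v + t *\<^sub>R u \<in> prob_simplex"
      by (intro convexD[OF convex_prob_simplex]) (use u v in auto)
    then show "?c t \<in> prob_simplex" by (simp add: algebra_simps)
  qed
  have "(f has_derivative (\<lambda>h. G v \<bullet> h)) (at (?c 0) within ?c ` {0..1})"
    using G v has_derivative_subset[OF _ img] by (auto simp: simplex_gradient_def)
  from has_derivative_in_compose[OF c this]
  have "((\<lambda>t. f (?c t)) has_derivative (\<lambda>t. t * (G v \<bullet> (u - v)))) (at 0 within {0..1})"
    by simp
  then have "((\<lambda>t. f (?c t)) has_real_derivative (G v \<bullet> (u - v))) (at 0 within {0..1})"
    by (simp add: has_field_derivative_def mult.commute[of _ "G v \<bullet> (u - v)"] 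
        mult_commute_abs)
  then show ?thesis
    by (simp add: has_field_derivative_iff)
qed

lemma segment_eventually_mem:
  "eventually (\<lambda>t::real. 0 < t \<and> t \<le> 1) (at 0 within {0..1})"
  by (auto simp: eventually_at_filter)

text \<open>By convexity every difference quotient on the segment from v to u is at most
  \<open>f u - f v\<close>, and the bound passes to the limit.\<close>

lemma convex_gradient_le:
  fixes f :: "real ^ 's::finite \<Rightarrow> real"
  assumes f: "convex_on prob_simplex f" and G: "simplex_gradient f G"
    and u: "u \<in> prob_simplex" and v: "v \<in> prob_simplex"
  shows "f v - f u \<le> G v \<bullet> (v - u)"
proof -
  have "eventually (\<lambda>t. (f (v + t *\<^sub>R (u - v)) - f v) / t \<le> f u - f v) (at 0 within {0..1})"
    using segment_eventually_mem
  proof eventually_elim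
    case (elim t)
    have "f ((1 - t) *\<^sub>R v + t *\<^sub>R u) \<le> (1 - t) * f v + t * f u"
      using elim u v by (intro convex_onD[OF f]) auto
    moreover have "(1 - t) *\<^sub>R v + t *\<^sub>R u = v + t *\<^sub>R (u - v)"
      by (simp add: algebra_simps)
    ultimately have "f (v + t *\<^sub>R (u - v)) - f v \<le> t * (f u - f v)"
      by (simp add: algebra_simps)
    then show ?case
      using elim by (simp add: pos_divide_le_eq mult.commute)
  qed
  then have "G v \<bullet> (u - v) \<le> f u - f v"
    by (rule tendsto_upperbound[OF simplex_gradient_limit[OF G u v]])
      (simp add: trivial_limit_within islimpt_Icc)
  then show ?thesis by (simp add: inner_diff_right)
qed

text \<open>Only directions between simplex points are bounded: \<open>G\<close> is fixed only up to
  multiples of the all-ones vector, so its coordinates may exceed \<open>l\<close>, whereas its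
  pairing with \<open>u - v\<close> is unaffected by such shifts.\<close>

lemma lipschitz_gradient_le:
  fixes f :: "real ^ 's::finite \<Rightarrow> real"
  assumes f: "lipschitz1_on l prob_simplex f" and G: "simplex_gradient f G"
    and u: "u \<in> prob_simplex" and v: "v \<in> prob_simplex"
  shows "\<bar>G v \<bullet> (u - v)\<bar> \<le> l * norm1 (u - v)"
proof -
  have "eventually (\<lambda>t. \<bar>(f (v + t *\<^sub>R (u - v)) - f v) / t\<bar> \<le> l * norm1 (u - v)) (at 0 within {0..1})"
    using segment_eventually_mem
  proof eventually_elim
    case (elim t)
    have "(1 - t) *\<^sub>R v + t *\<^sub>R u \<in> prob_simplex"
      using elim by (intro convexD[OF convex_prob_simplex]) (use u v in auto)
    moreover have "(1 - t) *\<^sub>R v + t *\<^sub>R u = v + t *\<^sub>R (u - v)"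
      by (simp add: algebra_simps)
    ultimately have "\<bar>f (v + t *\<^sub>R (u - v)) - f v\<bar> \<le> l * norm1 (v + t *\<^sub>R (u - v) - v)"
      using f v unfolding lipschitz1_on_def by metis
    also have "norm1 (v + t *\<^sub>R (u - v) - v) = t * norm1 (u - v)"
      using elim by (simp add: norm1_def abs_mult sum_distrib_left)
    finally show ?case
      using elim by (simp add: pos_divide_le_eq mult_ac)
  qed
  then show ?thesis
    by (rule tendsto_upperbound[OF tendsto_rabs[OF simplex_gradient_limit[OF G u v]]])
      (simp add: trivial_limit_within islimpt_Icc)
qed

section \<open>Occupancy measures, their supports and log ratios\<close>

locale finite_horizon_mdp =
  fixes N :: nat and p :: "('x::finite, 'a::finite) kernel" and \<mu>0 :: "real ^ ('x \<times> 'a)"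
  assumes kernel: "transition_kernel N p" and initial: "\<mu>0 \<in> prob_simplex"
begin

text \<open>The law of the state at step \<open>Suc n\<close>: it depends on \<open>\<pi>\<close> only through the first \<open>n\<close> steps.\<close>

definition state_marg :: "('x, 'a) policy \<Rightarrow> nat \<Rightarrow> 'x \<Rightarrow> real" where
  "state_marg \<pi> n x' = (\<Sum>s\<in>UNIV. occ p \<mu>0 \<pi> n $ s * p (Suc n) (fst s) (snd s) $ x')"

text \<open>Positivity is asked only at states that the policy reaches: \<open>occ_set_pos\<close>
  constrains \<open>policy_of\<close>, which is uniform at the other states whatever the policy does
  there.\<close>

definition exploring :: "('x, 'a) policy \<Rightarrow> bool" where
  "exploring \<pi> \<longleftrightarrow> (\<forall>n<N. \<forall>x. state_marg \<pi> n x \<noteq> 0 \<longrightarrow> (\<forall>a. 0 < \<pi> (Suc n) x $ a))"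

text \<open>The averaging policy is separate from the two compared ones because the telescoping
  produces the \<open>\<nu>\<close>-mean of \<open>ln (\<pi>' / \<pi>)\<close>. When the first two
  arguments coincide, the sum over steps is the divergence \<open>Gam\<close> (see
  \<open>Gam_occ\<close>).\<close>

definition log_ratio_at :: "('x, 'a) policy \<Rightarrow> ('x, 'a) policy \<Rightarrow> ('x, 'a) policy \<Rightarrow> nat \<Rightarrow> real" where
  "log_ratio_at \<nu> \<pi> \<pi>' n = (\<Sum>s\<in>UNIV. occ p \<mu>0 \<nu> (Suc n) $ s *
     ln (\<pi> (Suc n) (fst s) $ snd s / \<pi>' (Suc n) (fst s) $ snd s))"

definition log_ratio :: "('x, 'a) policy \<Rightarrow> ('x, 'a) policy \<Rightarrow> ('x, 'a) policy \<Rightarrow> real" where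
  "log_ratio \<nu> \<pi> \<pi>' = (\<Sum>n<N. log_ratio_at \<nu> \<pi> \<pi>' n)"

lemma kernel_simplex: "n < N \<Longrightarrow> p (Suc n) x a \<in> prob_simplex"
  using kernel by (auto simp: transition_kernel_def)

lemma policy_simplex: "\<pi> \<in> policies N \<Longrightarrow> n < N \<Longrightarrow> \<pi> (Suc n) x \<in> prob_simplex"
  by (auto simp: policies_def)

lemma occ_Suc: "occ p \<mu>0 \<pi> (Suc n) $ (x, a) = state_marg \<pi> n x * \<pi> (Suc n) x $ a"
  by (simp add: state_marg_def case_prod_beta sum_distrib_right)

declare occ.simps(2) [simp del]

lemma sum_occ_Suc:
  "(\<Sum>s\<in>UNIV. occ p \<mu>0 \<pi> (Suc n) $ s * h s)
     = (\<Sum>x\<in>UNIV. state_marg \<pi> n x * (\<Sum>a\<in>UNIV. \<pi> (Suc n) x $ a * h (x, a)))"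
  by (simp add: sum_UNIV_prod occ_Suc sum_distrib_left mult.assoc)

text \<open>Exchanging the sums pulls a function of the next state back through the kernel; both the
  variational induction and the telescoping rely on this.\<close>

lemma sum_state_marg:
  "(\<Sum>x\<in>UNIV. state_marg \<pi> n x * w x)
     = (\<Sum>s\<in>UNIV. occ p \<mu>0 \<pi> n $ s * (\<Sum>x\<in>UNIV. p (Suc n) (fst s) (snd s) $ x * w x))"
  unfolding state_marg_def sum_distrib_left sum_distrib_right
  by (subst sum.swap) (simp add: mult.assoc)

lemma occ_simplex:
  assumes \<pi>: "\<pi> \<in> policies N"
  shows "n \<le> N \<Longrightarrow> occ p \<mu>0 \<pi> n \<in> prob_simplex"
proof (induction n)
  case 0
  then show ?case by (simp add: initial)
next
  case (Suc n)
  then have IH: "occ p \<mu>0 \<pi> n \<in> prob_simplex" and n: "n < N" by auto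
  have marg: "0 \<le> state_marg \<pi> n x" for x
    unfolding state_marg_def
    using prob_simplexD(1)[OF IH] prob_simplexD(1)[OF kernel_simplex[OF n]]
    by (intro sum_nonneg mult_nonneg_nonneg) auto
  have "0 \<le> occ p \<mu>0 \<pi> (Suc n) $ s" for s
    using marg prob_simplexD(1)[OF policy_simplex[OF \<pi> n]] by (cases s) (simp add: occ_Suc)
  moreover have "(\<Sum>s\<in>UNIV. occ p \<mu>0 \<pi> (Suc n) $ s) = 1"
    using sum_occ_Suc[of \<pi> n "\<lambda>_. 1"] sum_state_marg[of \<pi> n "\<lambda>_. 1"]
    by (simp add: prob_simplexD(2)[OF policy_simplex[OF \<pi> n]]
        prob_simplexD(2)[OF kernel_simplex[OF n]] prob_simplexD(2)[OF IH])
  ultimately show ?case by (simp add: prob_simplex_def)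
qed

lemma state_marg_nonneg:
  assumes "\<pi> \<in> policies N" and "n < N"
  shows "0 \<le> state_marg \<pi> n x"
  unfolding state_marg_def
  using prob_simplexD(1)[OF occ_simplex[OF assms(1), of n]]
    prob_simplexD(1)[OF kernel_simplex[OF assms(2)]] assms(2)
  by (intro sum_nonneg mult_nonneg_nonneg) auto

lemma state_marg_pos:
  assumes \<pi>: "\<pi> \<in> policies N" and n: "n < N"
    and "occ p \<mu>0 \<pi> n $ (x, a) \<noteq> 0" and "p (Suc n) x a $ x' \<noteq> 0"
  shows "state_marg \<pi> n x' \<noteq> 0"
proof -
  have occ: "0 \<le> occ p \<mu>0 \<pi> n $ s" for s
    using prob_simplexD(1)[OF occ_simplex[OF \<pi>]] n by simp
  have ker: "0 \<le> p (Suc n) x a $ x'" for x a x'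
    using prob_simplexD(1)[OF kernel_simplex[OF n]] .
  have "0 < occ p \<mu>0 \<pi> n $ (x, a) * p (Suc n) x a $ x'"
    using assms(3,4) occ[of "(x, a)"] ker[of x a x'] by simp
  also have "\<dots> \<le> state_marg \<pi> n x'"
    unfolding state_marg_def
    using member_le_sum[of "(x, a)" UNIV "\<lambda>s. occ p \<mu>0 \<pi> n $ s * p (Suc n) (fst s) (snd s) $ x'"]
      occ ker by simp
  finally show ?thesis by simp
qed

text \<open>Exploration gives absolute continuity with respect to any other policy. By induction on
  the step, a state reached under \<open>\<nu>\<close> has a predecessor pair of positive
  \<open>\<pi>\<close>-mass, hence is reached under \<open>\<pi>\<close>, and there
  \<open>\<pi>\<close> plays every action.\<close>

lemma occ_support:
  assumes \<nu>: "\<nu> \<in> policies N" and \<pi>: "\<pi> \<in> policies N" and ex: "exploring \<pi>"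
  shows "n \<le> N \<Longrightarrow> occ p \<mu>0 \<nu> n $ s \<noteq> 0 \<Longrightarrow> occ p \<mu>0 \<pi> n $ s \<noteq> 0"
    and "n < N \<Longrightarrow> state_marg \<nu> n x \<noteq> 0 \<Longrightarrow> state_marg \<pi> n x \<noteq> 0"
proof -
  have marg: "state_marg \<pi> n x \<noteq> 0"
    if "n < N" and sub: "\<And>s. occ p \<mu>0 \<nu> n $ s \<noteq> 0 \<Longrightarrow> occ p \<mu>0 \<pi> n $ s \<noteq> 0"
      and "state_marg \<nu> n x \<noteq> 0" for n x
  proof -
    from that(3) obtain s where s: "occ p \<mu>0 \<nu> n $ s * p (Suc n) (fst s) (snd s) $ x \<noteq> 0"
      unfolding state_marg_def by (meson sum.neutral)
    then show ?thesis
      using state_marg_pos[OF \<pi> that(1), of "fst s" "snd s" x] sub[of s] by simp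
  qed
  have occ: "\<forall>s. occ p \<mu>0 \<nu> n $ s \<noteq> 0 \<longrightarrow> occ p \<mu>0 \<pi> n $ s \<noteq> 0" if "n \<le> N" for n
    using that
  proof (induction n)
    case 0
    then show ?case by simp
  next
    case (Suc n)
    show ?case
    proof (intro allI impI)
      fix s assume s: "occ p \<mu>0 \<nu> (Suc n) $ s \<noteq> 0"
      obtain x a where xa: "s = (x, a)" by (cases s)
      have m: "state_marg \<pi> n x \<noteq> 0"
        using marg[of n x] Suc s by (auto simp: xa occ_Suc)
      then have "0 < \<pi> (Suc n) x $ a"
        using ex Suc.prems by (auto simp: exploring_def)
      then show "occ p \<mu>0 \<pi> (Suc n) $ s \<noteq> 0"
        using m by (simp add: xa occ_Suc)
    qed
  qed
  show "n \<le> N \<Longrightarrow> occ p \<mu>0 \<nu> n $ s \<noteq> 0 \<Longrightarrow> occ p \<mu>0 \<pi> n $ s \<noteq> 0"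
    using occ by blast
  show "n < N \<Longrightarrow> state_marg \<nu> n x \<noteq> 0 \<Longrightarrow> state_marg \<pi> n x \<noteq> 0"
    using marg occ by (meson less_imp_le)
qed

lemma exploring_pos:
  assumes "\<nu> \<in> policies N" and "\<pi> \<in> policies N" and "exploring \<pi>"
    and "n < N" and "state_marg \<nu> n x \<noteq> 0"
  shows "0 < \<pi> (Suc n) x $ a"
  using occ_support(2)[OF assms] assms(3,4) by (auto simp: exploring_def)

section \<open>Nonnegativity of divergences and a Pinsker inequality\<close>

lemma log_ratio_at_nonneg:
  assumes \<pi>: "\<pi> \<in> policies N" and \<pi>': "\<pi>' \<in> policies N" "exploring \<pi>'" and n: "n < N"
  shows "0 \<le> log_ratio_at \<pi> \<pi> \<pi>' n"
  unfolding log_ratio_at_def sum_occ_Suc fst_conv snd_conv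
proof (rule sum_nonneg)
  fix x
  show "0 \<le> state_marg \<pi> n x *
      (\<Sum>a\<in>UNIV. \<pi> (Suc n) x $ a * ln (\<pi> (Suc n) x $ a / \<pi>' (Suc n) x $ a))"
  \<comment> \<open>\<open>\<pi>'\<close> may vanish at states that \<open>\<pi>\<close> does not
    reach; these have weight zero.\<close>
  proof (cases "state_marg \<pi> n x = 0")
    case False
    with gibbs_variational[OF policy_simplex[OF \<pi> n], of "\<pi>' (Suc n) x" x "\<lambda>_. 0"]
      exploring_pos[OF \<pi> \<pi>' n False]
    have "0 \<le> (\<Sum>a\<in>UNIV. \<pi> (Suc n) x $ a * ln (\<pi> (Suc n) x $ a / \<pi>' (Suc n) x $ a))"
      by (simp add: sum_negf prob_simplexD(2)[OF policy_simplex[OF \<pi>'(1) n]])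
    then show ?thesis
      using state_marg_nonneg[OF \<pi> n] by simp
  qed simp
qed

lemma log_ratio_nonneg:
  assumes "\<pi> \<in> policies N" and "\<pi>' \<in> policies N" "exploring \<pi>'"
  shows "0 \<le> log_ratio \<pi> \<pi> \<pi>'"
  unfolding log_ratio_def using log_ratio_at_nonneg[OF assms] by (intro sum_nonneg) auto

text \<open>
  Proving the Donsker-Varadhan inequality along the chain, by Jensen's inequality for the kernel and
  Gibbs' inequality for the policies, avoids the chain rule and data processing for relative entropy.
\<close>

lemma occ_variational:
  assumes \<pi>: "\<pi> \<in> policies N" and \<pi>': "\<pi>' \<in> policies N" "exploring \<pi>'"
  shows "n \<le> N \<Longrightarrow> (\<Sum>s\<in>UNIV. occ p \<mu>0 \<pi> n $ s * h s)
    \<le> (\<Sum>i<n. log_ratio_at \<pi> \<pi> \<pi>' i) + ln (\<Sum>s\<in>UNIV. occ p \<mu>0 \<pi>' n $ s * exp (h s))"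
proof (induction n arbitrary: h)
  case 0
  have "(\<Sum>s\<in>UNIV. \<mu>0 $ s * h s) = ln (exp (\<Sum>s\<in>UNIV. \<mu>0 $ s * h s))"
    by simp
  also have "\<dots> \<le> ln (\<Sum>s\<in>UNIV. \<mu>0 $ s * exp (h s))"
    using exp_jensen[OF initial, of h] sum_simplex_pos[OF initial, of "\<lambda>s. exp (h s)"]
    by (subst ln_le_cancel_iff) auto
  finally show ?case by simp
next
  case (Suc n)
  then have n: "n < N" by simp
  \<comment> \<open>\<open>W x\<close> is the \<open>\<pi>'\<close>-mean of \<open>exp h\<close> at
    state x. Averaging \<open>ln W\<close> over the kernel gives \<open>g\<close>, the test function
    for the induction hypothesis one step earlier, which is why \<open>h\<close> is arbitrary in the
    induction.\<close>
  define W where "W x = (\<Sum>a\<in>UNIV. \<pi>' (Suc n) x $ a * exp (h (x, a)))" for x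
  define g where "g s = (\<Sum>x\<in>UNIV. p (Suc n) (fst s) (snd s) $ x * ln (W x))" for s
  have W: "0 < W x" for x
    unfolding W_def by (intro sum_simplex_pos policy_simplex \<pi>' n) simp
  have occ': "occ p \<mu>0 \<pi>' n \<in> prob_simplex"
    using occ_simplex[OF \<pi>'(1)] n by simp
  have "(\<Sum>s\<in>UNIV. occ p \<mu>0 \<pi> (Suc n) $ s * h s)
      \<le> (\<Sum>x\<in>UNIV. state_marg \<pi> n x *
           ((\<Sum>a\<in>UNIV. \<pi> (Suc n) x $ a * ln (\<pi> (Suc n) x $ a / \<pi>' (Suc n) x $ a)) + ln (W x)))"
    unfolding sum_occ_Suc
  proof (rule sum_mono)
    fix x
    show "state_marg \<pi> n x * (\<Sum>a\<in>UNIV. \<pi> (Suc n) x $ a * h (x, a)) \<le> state_marg \<pi> n x *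
        ((\<Sum>a\<in>UNIV. \<pi> (Suc n) x $ a * ln (\<pi> (Suc n) x $ a / \<pi>' (Suc n) x $ a)) + ln (W x))"
    proof (cases "state_marg \<pi> n x = 0")
      case False
      with gibbs_variational[OF policy_simplex[OF \<pi> n], of "\<pi>' (Suc n) x" x "\<lambda>a. h (x, a)"]
        exploring_pos[OF \<pi> \<pi>' n False]
      have "(\<Sum>a\<in>UNIV. \<pi> (Suc n) x $ a * h (x, a))
          \<le> (\<Sum>a\<in>UNIV. \<pi> (Suc n) x $ a * ln (\<pi> (Suc n) x $ a / \<pi>' (Suc n) x $ a)) + ln (W x)"
        by (simp add: W_def right_diff_distrib sum_subtractf)
      then show ?thesis
        using state_marg_nonneg[OF \<pi> n] by (intro mult_left_mono)
    qed simp
  qed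
  also have "\<dots> = log_ratio_at \<pi> \<pi> \<pi>' n + (\<Sum>s\<in>UNIV. occ p \<mu>0 \<pi> n $ s * g s)"
    by (simp add: log_ratio_at_def sum_occ_Suc g_def distrib_left sum.distrib flip: sum_state_marg)
  also have "\<dots> \<le> (\<Sum>i<Suc n. log_ratio_at \<pi> \<pi> \<pi>' i)
      + ln (\<Sum>s\<in>UNIV. occ p \<mu>0 \<pi>' n $ s * exp (g s))"
    using Suc.IH[of g] n by simp
  \<comment> \<open>Jensen's inequality for the kernel bounds \<open>exp (g s)\<close> by the kernel
    mean of \<open>W\<close>, which turns the law at step n into the law at step
    \<open>Suc n\<close>.\<close>
  also have "ln (\<Sum>s\<in>UNIV. occ p \<mu>0 \<pi>' n $ s * exp (g s))
      \<le> ln (\<Sum>s\<in>UNIV. occ p \<mu>0 \<pi>' (Suc n) $ s * exp (h s))"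
  proof -
    have "exp (g s) \<le> (\<Sum>x\<in>UNIV. p (Suc n) (fst s) (snd s) $ x * W x)" for s
      using exp_jensen[OF kernel_simplex[OF n], of "fst s" "snd s" "\<lambda>x. ln (W x)"] W
      by (simp add: g_def)
    then have "(\<Sum>s\<in>UNIV. occ p \<mu>0 \<pi>' n $ s * exp (g s))
        \<le> (\<Sum>s\<in>UNIV. occ p \<mu>0 \<pi>' n $ s * (\<Sum>x\<in>UNIV. p (Suc n) (fst s) (snd s) $ x * W x))"
      using prob_simplexD(1)[OF occ'] by (intro sum_mono mult_left_mono)
    also have "\<dots> = (\<Sum>s\<in>UNIV. occ p \<mu>0 \<pi>' (Suc n) $ s * exp (h s))"
      by (simp only: sum_occ_Suc W_def flip: sum_state_marg)
    finally show ?thesis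
      using sum_simplex_pos[OF occ', of "\<lambda>s. exp (g s)"] by simp
  qed
  finally show ?case by simp
qed

text \<open>Testing the variational inequality with s times the sign of the difference produces the
  L1 norm, and \<open>sign_mgf_bound\<close> controls the exponential moment. Leaving s free gives a
  bound linear in the divergence, which can later be cancelled.\<close>

lemma occ_pinsker:
  assumes \<pi>: "\<pi> \<in> policies N" and \<pi>': "\<pi>' \<in> policies N" "exploring \<pi>'"
    and n: "n \<le> N" and s: "0 \<le> s"
  shows "s * norm1 (occ p \<mu>0 \<pi> n - occ p \<mu>0 \<pi>' n) \<le> log_ratio \<pi> \<pi> \<pi>' + s\<^sup>2 / 2"
proof -
  define e :: "'x \<times> 'a \<Rightarrow> real" where
    "e i = (if occ p \<mu>0 \<pi>' n $ i \<le> occ p \<mu>0 \<pi> n $ i then 1 else -1)" for i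
  have e: "e i = 1 \<or> e i = -1" for i
    by (simp add: e_def)
  have "s * (\<Sum>i\<in>UNIV. occ p \<mu>0 \<pi> n $ i * e i)
      \<le> (\<Sum>i<n. log_ratio_at \<pi> \<pi> \<pi>' i) + ln (\<Sum>i\<in>UNIV. occ p \<mu>0 \<pi>' n $ i * exp (s * e i))"
    using occ_variational[OF \<pi> \<pi>' n, of "\<lambda>i. s * e i"]
    by (simp add: sum_distrib_left mult.left_commute)
  \<comment> \<open>The remaining steps contribute nonnegative terms, so one divergence serves every
    n.\<close>
  also have "(\<Sum>i<n. log_ratio_at \<pi> \<pi> \<pi>' i) \<le> log_ratio \<pi> \<pi> \<pi>'"
    unfolding log_ratio_def using n log_ratio_at_nonneg[OF \<pi> \<pi>']
    by (intro sum_mono2) auto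
  also have "ln (\<Sum>i\<in>UNIV. occ p \<mu>0 \<pi>' n $ i * exp (s * e i))
      \<le> s * (\<Sum>i\<in>UNIV. occ p \<mu>0 \<pi>' n $ i * e i) + s\<^sup>2 / 2"
    using sign_mgf_bound[OF occ_simplex[OF \<pi>'(1) n] e s] .
  finally have "s * ((\<Sum>i\<in>UNIV. occ p \<mu>0 \<pi> n $ i * e i) - (\<Sum>i\<in>UNIV. occ p \<mu>0 \<pi>' n $ i * e i))
      \<le> log_ratio \<pi> \<pi> \<pi>' + s\<^sup>2 / 2"
    by (simp add: right_diff_distrib)
  also have "(\<Sum>i\<in>UNIV. occ p \<mu>0 \<pi> n $ i * e i) - (\<Sum>i\<in>UNIV. occ p \<mu>0 \<pi>' n $ i * e i)
      = norm1 (occ p \<mu>0 \<pi> n - occ p \<mu>0 \<pi>' n)"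
    by (simp add: norm1_def e_def flip: sum_subtractf) (auto intro!: sum.cong)
  finally show ?thesis .
qed

section \<open>One mirror descent step and its soft Bellman equation\<close>

definition md_step :: "real \<Rightarrow> (nat \<Rightarrow> real ^ ('x \<times> 'a) \<Rightarrow> real ^ ('x \<times> 'a)) \<Rightarrow> ('x, 'a) policy
    \<Rightarrow> ('x, 'a) policy" where
  "md_step t G \<pi> n x = (\<chi> a. \<pi> n x $ a * exp (t * md_Q N p G t \<pi> (occ p \<mu>0 \<pi>) n x a) /
     (\<Sum>a'\<in>UNIV. \<pi> n x $ a' * exp (t * md_Q N p G t \<pi> (occ p \<mu>0 \<pi>) n x a')))"

text \<open>\<open>t\<close> times the optimal regularised value of state \<open>x\<close> at step \<open>n\<close>.\<close>

definition soft_value :: "real \<Rightarrow> (nat \<Rightarrow> real ^ ('x \<times> 'a) \<Rightarrow> real ^ ('x \<times> 'a)) \<Rightarrow> ('x, 'a) policy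
    \<Rightarrow> nat \<Rightarrow> 'x \<Rightarrow> real" where
  "soft_value t G \<pi> n x = ln (\<Sum>a\<in>UNIV. \<pi> n x $ a * exp (t * md_Q N p G t \<pi> (occ p \<mu>0 \<pi>) n x a))"

lemma md_curl_Suc:
  "md_curl N p \<mu>0 G \<tau> \<pi> (Suc k) = md_step (\<tau> k) G (md_curl N p \<mu>0 G \<tau> \<pi> k)"
  by (simp add: md_step_def Let_def fun_eq_iff)

lemma md_normaliser_pos:
  assumes "\<pi> \<in> policies N" and "n < N"
  shows "0 < (\<Sum>a\<in>UNIV. \<pi> (Suc n) x $ a * exp (t * Q a))"
  using assms by (intro sum_simplex_pos policy_simplex) auto

lemma md_step_pos:
  assumes "\<pi> \<in> policies N" and "n < N" and "0 < \<pi> (Suc n) x $ a"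
  shows "0 < md_step t G \<pi> (Suc n) x $ a"
  using md_normaliser_pos[OF assms(1,2)] assms(3) by (simp add: md_step_def)

lemma md_step_policies:
  assumes \<pi>: "\<pi> \<in> policies N"
  shows "md_step t G \<pi> \<in> policies N"
proof -
  have "md_step t G \<pi> (Suc n) x \<in> prob_simplex" if n: "n < N" for n x
    using md_normaliser_pos[OF \<pi> n] prob_simplexD(1)[OF policy_simplex[OF \<pi> n]]
    by (auto simp: prob_simplex_def md_step_def less_imp_le less_imp_neq[symmetric]
        simp flip: sum_divide_distrib)
  then show ?thesis
    unfolding policies_def by (auto simp: Suc_le_eq dest!: gr0_implies_Suc)
qed

text \<open>A state reached by the new policy is reached by \<open>\<pi>\<close> as well, since
  \<open>\<pi>\<close> is exploring; there \<open>\<pi>\<close> is positive, and the multiplicative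
  update preserves this.\<close>

lemma md_step_exploring:
  assumes \<pi>: "\<pi> \<in> policies N" "exploring \<pi>"
  shows "exploring (md_step t G \<pi>)"
  using exploring_pos[OF md_step_policies[OF \<pi>(1)] \<pi>] md_step_pos[OF \<pi>(1)]
  by (auto simp: exploring_def)

lemma ln_md_step:
  assumes \<pi>: "\<pi> \<in> policies N" and n: "n < N" and pos: "0 < \<pi> (Suc n) x $ a"
  shows "ln (md_step t G \<pi> (Suc n) x $ a / \<pi> (Suc n) x $ a)
    = t * md_Q N p G t \<pi> (occ p \<mu>0 \<pi>) (Suc n) x a - soft_value t G \<pi> (Suc n) x"
  using md_normaliser_pos[OF \<pi> n, of x t "md_Q N p G t \<pi> (occ p \<mu>0 \<pi>) (Suc n) x"] pos
  by (simp add: md_step_def soft_value_def ln_div ln_mult)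

text \<open>
  States of \<open>\<pi>\<close>-mass zero carry junk values of \<open>md_Q\<close>, but they are never entered from a pair of
  positive \<open>\<pi>\<close>-mass, so the supremum may be evaluated by Gibbs' principle state by state.
\<close>

lemma soft_bellman:
  assumes \<pi>: "\<pi> \<in> policies N" "exploring \<pi>" and t: "0 < t" and n: "Suc n < N"
    and occ: "occ p \<mu>0 \<pi> (Suc n) $ (x, a) \<noteq> 0"
  shows "t * md_Q N p G t \<pi> (occ p \<mu>0 \<pi>) (Suc n) x a
    = - t * G (Suc n) (occ p \<mu>0 \<pi> (Suc n)) $ (x, a)
      + (\<Sum>x'\<in>UNIV. p (Suc (Suc n)) x a $ x' * soft_value t G \<pi> (Suc (Suc n)) x')"
proof -
  let ?Q = "md_Q N p G t \<pi> (occ p \<mu>0 \<pi>) (Suc (Suc n))"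
  let ?V = "soft_value t G \<pi> (Suc (Suc n))"
  let ?r = "\<pi> (Suc (Suc n))"
  let ?p = "\<lambda>x'. p (Suc (Suc n)) x a $ x'"
  let ?in = "\<lambda>q x'. \<Sum>a'\<in>UNIV. q x' $ a' * (- (1 / t) * ln (q x' $ a' / ?r x' $ a') + ?Q x' a')"
  let ?g = "G (Suc n) (occ p \<mu>0 \<pi> (Suc n)) $ (x, a)"
  have r: "0 < ?r x' $ a'" if "?p x' \<noteq> 0" for x' a'
    using state_marg_pos[OF \<pi>(1) n occ that] \<pi>(2) n by (auto simp: exploring_def)
  have p: "0 \<le> ?p x'" for x'
    using prob_simplexD(1)[OF kernel_simplex[OF n]] .
  \<comment> \<open>Pulling out 1 / t gives the entropy term coefficient 1, the form of Gibbs'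
    inequality.\<close>
  have inner: "?in q x' = (\<Sum>a'\<in>UNIV. q x' $ a' * (t * ?Q x' a' - ln (q x' $ a' / ?r x' $ a'))) / t"
    for q x'
    unfolding sum_divide_distrib using t by (intro sum.cong) (auto simp: field_simps)
  have le: "?p x' * ?in q x' \<le> ?p x' * (?V x' / t)" if "\<forall>x'. q x' \<in> prob_simplex" for q x'
  proof (cases "?p x' = 0")
    case False
    have "?in q x' \<le> ?V x' / t"
      unfolding inner soft_value_def using that r[OF False] t
      by (intro divide_right_mono gibbs_variational) auto
    then show ?thesis using p by (intro mult_left_mono)
  qed simp
  obtain q0 :: "real ^ 'a" where q0: "q0 \<in> prob_simplex"
    using prob_simplex_nonempty by blast
  \<comment> \<open>The Gibbs distribution at states that can be entered; elsewhere
    \<open>?r\<close> may have zero entries, and any distribution will do.\<close>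
  define q where "q x' = (if ?p x' = 0 then q0 else
    \<chi> a'. ?r x' $ a' * exp (t * ?Q x' a') / (\<Sum>a'\<in>UNIV. ?r x' $ a' * exp (t * ?Q x' a')))" for x'
  have q: "\<forall>x'. q x' \<in> prob_simplex"
    using q0 gibbs_attained(2)[OF r] by (auto simp: q_def)
  have eq: "?p x' * ?in q x' = ?p x' * (?V x' / t)" for x'
  proof (cases "?p x' = 0")
    case False
    have "?in q x' = ?V x' / t"
      unfolding inner soft_value_def
      using gibbs_attained(1)[OF r[OF False], of "\<lambda>a'. t * ?Q x' a'"] False by (simp add: q_def)
    then show ?thesis by simp
  qed simp
  have "md_Q N p G t \<pi> (occ p \<mu>0 \<pi>) (Suc n) x a
      = (SUP q \<in> {q. \<forall>x'. q x' \<in> prob_simplex}. - ?g + (\<Sum>x'\<in>UNIV. ?p x' * ?in q x'))"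
    using n by (subst md_Q.simps) simp
  also have "\<dots> = - ?g + (\<Sum>x'\<in>UNIV. ?p x' * (?V x' / t))"
  proof (rule cSup_eq_maximum)
    show "- ?g + (\<Sum>x'\<in>UNIV. ?p x' * (?V x' / t))
        \<in> (\<lambda>q. - ?g + (\<Sum>x'\<in>UNIV. ?p x' * ?in q x')) ` {q. \<forall>x'. q x' \<in> prob_simplex}"
      using q by (intro image_eqI[of _ _ q]) (simp_all only: eq mem_Collect_eq simp_thms)
  next
    fix y assume "y \<in> (\<lambda>q. - ?g + (\<Sum>x'\<in>UNIV. ?p x' * ?in q x')) ` {q. \<forall>x'. q x' \<in> prob_simplex}"
    then obtain q where "\<forall>x'. q x' \<in> prob_simplex" "y = - ?g + (\<Sum>x'\<in>UNIV. ?p x' * ?in q x')"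
      by blast
    then show "y \<le> - ?g + (\<Sum>x'\<in>UNIV. ?p x' * (?V x' / t))"
      using le[of q] by (simp only:) (intro add_left_mono sum_mono, simp)
  qed
  finally have Q: "md_Q N p G t \<pi> (occ p \<mu>0 \<pi>) (Suc n) x a
      = - ?g + (\<Sum>x'\<in>UNIV. ?p x' * (?V x' / t))" .
  have "t * (\<Sum>x'\<in>UNIV. ?p x' * (?V x' / t)) = (\<Sum>x'\<in>UNIV. ?p x' * ?V x')"
    using t by (simp add: sum_distrib_left)
  then show ?thesis
    by (simp only: Q distrib_left mult_minus_right mult_minus_left)
qed

text \<open>On pairs of positive \<open>\<nu>\<close>-mass, \<open>soft_bellman\<close> and
  \<open>ln_md_step\<close> write t times the gradient as expected next soft value minus current
  soft value minus log ratio; the \<open>\<nu>\<close>-means telescope. What remains at step 0 is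
  the same for every \<open>\<nu>\<close>, as \<open>state_marg\<close> at 0 depends only on
  \<open>\<mu>0\<close> and the kernel.\<close>

lemma md_step_linear_cost:
  assumes \<pi>: "\<pi> \<in> policies N" "exploring \<pi>" and \<nu>: "\<nu> \<in> policies N" and t: "0 < t" and N: "0 < N"
  shows "t * (\<Sum>n<N. G (Suc n) (occ p \<mu>0 \<pi> (Suc n)) \<bullet> occ p \<mu>0 \<nu> (Suc n))
    = - (\<Sum>x\<in>UNIV. state_marg \<nu> 0 x * soft_value t G \<pi> (Suc 0) x)
      - log_ratio \<nu> (md_step t G \<pi>) \<pi>"
proof -
  \<comment> \<open>The value 0 at N reflects that \<open>md_Q\<close> has no continuation term at
    the last step.\<close>
  define B where
    "B n = (if n < N then \<Sum>x\<in>UNIV. state_marg \<nu> n x * soft_value t G \<pi> (Suc n) x else 0)" for n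
  have step: "t * (G (Suc n) (occ p \<mu>0 \<pi> (Suc n)) \<bullet> occ p \<mu>0 \<nu> (Suc n))
      = (B (Suc n) - B n) - log_ratio_at \<nu> (md_step t G \<pi>) \<pi> n" if n: "n < N" for n
  proof -
    let ?g = "\<lambda>s. G (Suc n) (occ p \<mu>0 \<pi> (Suc n)) $ s"
    let ?o = "\<lambda>s. occ p \<mu>0 \<nu> (Suc n) $ s"
    let ?V = "soft_value t G \<pi> (Suc n)"
    let ?next = "\<lambda>s. if Suc n < N then
      \<Sum>x\<in>UNIV. p (Suc (Suc n)) (fst s) (snd s) $ x * soft_value t G \<pi> (Suc (Suc n)) x else 0"
    let ?l = "\<lambda>s. ln (md_step t G \<pi> (Suc n) (fst s) $ snd s / \<pi> (Suc n) (fst s) $ snd s)"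
    have summand: "?o s * (t * ?g s) = ?o s * ?next s - ?o s * ?V (fst s) - ?o s * ?l s" for s
    proof (cases "?o s = 0")
      case False
      obtain x a where s: "s = (x, a)" by (cases s)
      have o: "occ p \<mu>0 \<pi> (Suc n) $ (x, a) \<noteq> 0"
        using occ_support(1)[OF \<nu> \<pi>, of "Suc n" s] n False by (simp add: s)
      then have "0 < \<pi> (Suc n) x $ a"
        using \<pi>(2) n by (auto simp: exploring_def occ_Suc)
      from ln_md_step[OF \<pi>(1) n this, of t G]
      have l: "?l s = t * md_Q N p G t \<pi> (occ p \<mu>0 \<pi>) (Suc n) x a - ?V x"
        by (simp add: s)
      have "t * md_Q N p G t \<pi> (occ p \<mu>0 \<pi>) (Suc n) x a = - t * ?g s + ?next s"
      proof (cases "Suc n < N")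
        case True
        then show ?thesis using soft_bellman[OF \<pi> t True o, of G] by (simp add: s)
      next
        case False
        then have "Suc n = N" using n by simp
        then show ?thesis by (subst md_Q.simps) (auto simp: s)
      qed
      then have "t * ?g s = ?next s - ?V (fst s) - ?l s"
        unfolding l by (simp add: s)
      then show ?thesis by (simp add: right_diff_distrib)
    qed simp
    have "t * (G (Suc n) (occ p \<mu>0 \<pi> (Suc n)) \<bullet> occ p \<mu>0 \<nu> (Suc n)) = (\<Sum>s\<in>UNIV. ?o s * (t * ?g s))"
      by (simp add: inner_vec_def sum_distrib_left mult_ac)
    also have "\<dots> = (\<Sum>s\<in>UNIV. ?o s * ?next s) - (\<Sum>s\<in>UNIV. ?o s * ?V (fst s)) - (\<Sum>s\<in>UNIV. ?o s * ?l s)"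
      by (simp only: summand sum_subtractf)
    also have "(\<Sum>s\<in>UNIV. ?o s * ?next s) = B (Suc n)"
      by (simp add: B_def sum_state_marg)
    also have "(\<Sum>s\<in>UNIV. ?o s * ?V (fst s)) = B n"
      using n by (simp add: B_def sum_occ_Suc prob_simplexD(2)[OF policy_simplex[OF \<nu> n]]
          flip: sum_distrib_right)
    finally show ?thesis by (simp add: log_ratio_at_def)
  qed
  have "t * (\<Sum>n<N. G (Suc n) (occ p \<mu>0 \<pi> (Suc n)) \<bullet> occ p \<mu>0 \<nu> (Suc n))
      = (\<Sum>n<N. (B (Suc n) - B n) - log_ratio_at \<nu> (md_step t G \<pi>) \<pi> n)"
    unfolding sum_distrib_left by (intro sum.cong) (simp_all add: step)
  also have "\<dots> = (B N - B 0) - log_ratio \<nu> (md_step t G \<pi>) \<pi>"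
    by (subst sum_subtractf) (simp only: sum_lessThan_telescope log_ratio_def)
  finally show ?thesis
    using N by (simp add: B_def)
qed

text \<open>Wherever \<open>\<nu>\<close> puts mass all three policies are positive, so the
  logarithms of the quotients split.\<close>

lemma log_ratio_diff:
  assumes \<nu>: "\<nu> \<in> policies N" and \<pi>: "\<pi> \<in> policies N" "exploring \<pi>"
    and \<pi>': "\<pi>' \<in> policies N" "exploring \<pi>'"
  shows "log_ratio \<nu> \<pi>' \<pi> = log_ratio \<nu> \<nu> \<pi> - log_ratio \<nu> \<nu> \<pi>'"
proof -
  have "log_ratio_at \<nu> \<pi>' \<pi> n = log_ratio_at \<nu> \<nu> \<pi> n - log_ratio_at \<nu> \<nu> \<pi>' n" if n: "n < N" for n
    unfolding log_ratio_at_def sum_subtractf[symmetric]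
  proof (intro sum.cong refl)
    fix s :: "'x \<times> 'a"
    obtain x a where s: "s = (x, a)" by (cases s)
    show "occ p \<mu>0 \<nu> (Suc n) $ s * ln (\<pi>' (Suc n) (fst s) $ snd s / \<pi> (Suc n) (fst s) $ snd s)
      = occ p \<mu>0 \<nu> (Suc n) $ s * ln (\<nu> (Suc n) (fst s) $ snd s / \<pi> (Suc n) (fst s) $ snd s)
        - occ p \<mu>0 \<nu> (Suc n) $ s * ln (\<nu> (Suc n) (fst s) $ snd s / \<pi>' (Suc n) (fst s) $ snd s)"
    proof (cases "occ p \<mu>0 \<nu> (Suc n) $ s = 0")
      case False
      then have m: "state_marg \<nu> n x \<noteq> 0" and "\<nu> (Suc n) x $ a \<noteq> 0"
        by (auto simp: s occ_Suc)
      then have "0 < \<nu> (Suc n) x $ a"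
        using prob_simplexD(1)[OF policy_simplex[OF \<nu> n], of x a] by simp
      then show ?thesis
        using exploring_pos[OF \<nu> \<pi> n m, of a] exploring_pos[OF \<nu> \<pi>' n m, of a]
        by (simp add: s ln_div right_diff_distrib)
    qed simp
  qed
  then show ?thesis
    by (simp add: log_ratio_def sum_subtractf)
qed

section \<open>The one-step inequality\<close>

lemma objective_alt: "objective N f \<mu> = (\<Sum>n<N. f (Suc n) (\<mu> (Suc n)))"
  by (simp add: objective_def sum.atLeast1_atMost_eq)

text \<open>Made for summation along the iterates: the divergences telescope and only the quadratic
  term accumulates.\<close>

lemma md_step_descent:
  assumes cvx: "\<And>n. n \<in> {1..N} \<Longrightarrow> convex_on prob_simplex (f n)"
    and grad: "\<And>n. n \<in> {1..N} \<Longrightarrow> simplex_gradient (f n) (G n)"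
    and lip: "\<And>n. n \<in> {1..N} \<Longrightarrow> lipschitz1_on l prob_simplex (f n)"
    and l: "0 \<le> l" and N: "0 < N" and t: "0 < t"
    and \<pi>: "\<pi> \<in> policies N" "exploring \<pi>" and \<nu>: "\<nu> \<in> policies N"
  shows "t * (objective N f (occ p \<mu>0 \<pi>) - objective N f (occ p \<mu>0 \<nu>))
    \<le> log_ratio \<nu> \<nu> \<pi> - log_ratio \<nu> \<nu> (md_step t G \<pi>) + (t * (l * real N))\<^sup>2 / 2"
proof -
  define \<pi>' where "\<pi>' = md_step t G \<pi>"
  have \<pi>': "\<pi>' \<in> policies N" "exploring \<pi>'"
    using md_step_policies[OF \<pi>(1)] md_step_exploring[OF \<pi>] by (auto simp: \<pi>'_def)
  define g where "g n = G (Suc n) (occ p \<mu>0 \<pi> (Suc n))" for n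
  have occ: "occ p \<mu>0 \<rho> (Suc n) \<in> prob_simplex" if "\<rho> \<in> policies N" "n < N" for \<rho> n
    using occ_simplex[OF that(1)] that(2) by simp
  \<comment> \<open>Pinsker at this s bounds N times each single-step term by the full divergence
    plus s^2 / 2; each of the N steps is then charged one N-th of that.\<close>
  define s where "s = t * (l * real N)"
  have s: "0 \<le> s" using t l by (simp add: s_def)
  have at_n: "t * (f (Suc n) (occ p \<mu>0 \<pi> (Suc n)) - f (Suc n) (occ p \<mu>0 \<nu> (Suc n)))
      \<le> t * (g n \<bullet> occ p \<mu>0 \<pi>' (Suc n)) - t * (g n \<bullet> occ p \<mu>0 \<nu> (Suc n))
        + (log_ratio \<pi>' \<pi>' \<pi> + s\<^sup>2 / 2) / real N" if n: "n < N" for n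
  proof -
    have n': "Suc n \<in> {1..N}" using n by simp
    have "f (Suc n) (occ p \<mu>0 \<pi> (Suc n)) - f (Suc n) (occ p \<mu>0 \<nu> (Suc n))
        \<le> g n \<bullet> (occ p \<mu>0 \<pi> (Suc n) - occ p \<mu>0 \<nu> (Suc n))"
      unfolding g_def by (rule convex_gradient_le[OF cvx[OF n'] grad[OF n'] occ[OF \<nu> n] occ[OF \<pi>(1) n]])
    also have "\<dots> = g n \<bullet> occ p \<mu>0 \<pi>' (Suc n) - g n \<bullet> occ p \<mu>0 \<nu> (Suc n)
        + g n \<bullet> (occ p \<mu>0 \<pi> (Suc n) - occ p \<mu>0 \<pi>' (Suc n))"
      by (simp add: inner_diff_right)
    finally have a: "f (Suc n) (occ p \<mu>0 \<pi> (Suc n)) - f (Suc n) (occ p \<mu>0 \<nu> (Suc n))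
        \<le> g n \<bullet> occ p \<mu>0 \<pi>' (Suc n) - g n \<bullet> occ p \<mu>0 \<nu> (Suc n)
          + l * norm1 (occ p \<mu>0 \<pi>' (Suc n) - occ p \<mu>0 \<pi> (Suc n))"
      using lipschitz_gradient_le[OF lip[OF n'] grad[OF n'] occ[OF \<pi>'(1) n] occ[OF \<pi>(1) n]]
      by (simp add: g_def inner_diff_right)
    have "real N * (t * (l * norm1 (occ p \<mu>0 \<pi>' (Suc n) - occ p \<mu>0 \<pi> (Suc n))))
        \<le> log_ratio \<pi>' \<pi>' \<pi> + s\<^sup>2 / 2"
      using occ_pinsker[OF \<pi>'(1) \<pi> _ s, of "Suc n"] n by (simp add: s_def mult_ac)
    then have b: "t * (l * norm1 (occ p \<mu>0 \<pi>' (Suc n) - occ p \<mu>0 \<pi> (Suc n)))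
        \<le> (log_ratio \<pi>' \<pi>' \<pi> + s\<^sup>2 / 2) / real N"
      using N by (simp add: pos_le_divide_eq mult.commute)
    show ?thesis
      using mult_left_mono[OF a, of t] b t by (simp add: right_diff_distrib distrib_left)
  qed
  have "t * (objective N f (occ p \<mu>0 \<pi>) - objective N f (occ p \<mu>0 \<nu>))
      = (\<Sum>n<N. t * (f (Suc n) (occ p \<mu>0 \<pi> (Suc n)) - f (Suc n) (occ p \<mu>0 \<nu> (Suc n))))"
    by (simp add: objective_alt sum_distrib_left flip: sum_subtractf)
  also have "\<dots> \<le> (\<Sum>n<N. t * (g n \<bullet> occ p \<mu>0 \<pi>' (Suc n)) - t * (g n \<bullet> occ p \<mu>0 \<nu> (Suc n))
        + (log_ratio \<pi>' \<pi>' \<pi> + s\<^sup>2 / 2) / real N)"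
    using at_n by (intro sum_mono) auto
  also have "\<dots> = t * (\<Sum>n<N. g n \<bullet> occ p \<mu>0 \<pi>' (Suc n)) - t * (\<Sum>n<N. g n \<bullet> occ p \<mu>0 \<nu> (Suc n))
        + (log_ratio \<pi>' \<pi>' \<pi> + s\<^sup>2 / 2)"
    using N by (simp add: sum.distrib sum_subtractf sum_distrib_left)
  \<comment> \<open>The initial soft values for \<open>\<pi>'\<close> and \<open>\<nu>\<close>
    coincide and cancel.\<close>
  also have "\<dots> = log_ratio \<nu> \<pi>' \<pi> - log_ratio \<pi>' \<pi>' \<pi> + (log_ratio \<pi>' \<pi>' \<pi> + s\<^sup>2 / 2)"
    using md_step_linear_cost[OF \<pi> \<pi>'(1) t N, of G] md_step_linear_cost[OF \<pi> \<nu> t N, of G]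
    by (simp add: g_def \<pi>'_def state_marg_def)
  also have "\<dots> = log_ratio \<nu> \<nu> \<pi> - log_ratio \<nu> \<nu> \<pi>' + s\<^sup>2 / 2"
    using log_ratio_diff[OF \<nu> \<pi> \<pi>'] by simp
  finally show ?thesis by (simp add: \<pi>'_def s_def)
qed

section \<open>Invariants of the iteration and identification of \<open>Gam\<close>\<close>

lemma md_curl_invariant:
  assumes "\<pi> \<in> policies N" and "exploring \<pi>"
  shows "md_curl N p \<mu>0 G \<tau> \<pi> k \<in> policies N \<and> exploring (md_curl N p \<mu>0 G \<tau> \<pi> k)"
proof (induction k)
  case 0
  then show ?case using assms by simp
next
  case (Suc k)
  then show ?case
    by (simp only: md_curl_Suc md_step_policies md_step_exploring)
qed

lemma policy_of_occ:
  assumes \<pi>: "\<pi> \<in> policies N" and n: "n < N" and m: "state_marg \<pi> n x \<noteq> 0"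
  shows "policy_of (occ p \<mu>0 \<pi>) (Suc n) x = \<pi> (Suc n) x"
proof -
  have "(\<Sum>a\<in>UNIV. occ p \<mu>0 \<pi> (Suc n) $ (x, a)) = state_marg \<pi> n x"
    by (simp add: occ_Suc prob_simplexD(2)[OF policy_simplex[OF \<pi> n]] flip: sum_distrib_left)
  then show ?thesis
    using m by (simp add: policy_of_def vec_eq_iff occ_Suc)
qed

lemma exploring_if_occ_set_pos:
  assumes \<pi>: "\<pi> \<in> policies N" and pos: "occ p \<mu>0 \<pi> \<in> occ_set_pos N p \<mu>0"
  shows "exploring \<pi>"
  unfolding exploring_def
proof (intro allI impI)
  fix n x a assume n: "n < N" and m: "state_marg \<pi> n x \<noteq> 0"
  have "policy_of (occ p \<mu>0 \<pi>) (Suc n) x $ a \<noteq> 0"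
    using pos n by (simp add: occ_set_pos_def)
  then show "0 < \<pi> (Suc n) x $ a"
    using policy_of_occ[OF \<pi> n m] prob_simplexD(1)[OF policy_simplex[OF \<pi> n], of x a] by simp
qed

text \<open>\<open>policy_of\<close> can differ from the inducing policy only at states of mass
  zero; by \<open>occ_support\<close> a state with \<open>\<nu>\<close>-mass has
  \<open>\<pi>\<close>-mass, so every discrepancy has weight zero.\<close>

lemma Gam_occ:
  assumes \<nu>: "\<nu> \<in> policies N" and \<pi>: "\<pi> \<in> policies N" "exploring \<pi>"
  shows "Gam N (occ p \<mu>0 \<nu>) (occ p \<mu>0 \<pi>) = log_ratio \<nu> \<nu> \<pi>"
proof -
  have "occ p \<mu>0 \<nu> (Suc n) $ s * ln (policy_of (occ p \<mu>0 \<nu>) (Suc n) (fst s) $ snd s /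
        policy_of (occ p \<mu>0 \<pi>) (Suc n) (fst s) $ snd s)
    = occ p \<mu>0 \<nu> (Suc n) $ s * ln (\<nu> (Suc n) (fst s) $ snd s / \<pi> (Suc n) (fst s) $ snd s)"
    if n: "n < N" for n s
  proof (cases "state_marg \<nu> n (fst s) = 0")
    case True
    then have "occ p \<mu>0 \<nu> (Suc n) $ s = 0"
      using occ_Suc[of \<nu> n "fst s" "snd s"] by simp
    then show ?thesis by simp
  next
    case False
    then show ?thesis
      using policy_of_occ[OF \<nu> n] policy_of_occ[OF \<pi>(1) n] occ_support(2)[OF \<nu> \<pi> n] by simp
  qed
  then show ?thesis
    unfolding Gam_def log_ratio_def log_ratio_at_def One_nat_def sum.atLeast1_atMost_eq
    by (intro sum.cong refl) (simp only: case_prod_beta prod.collapse lessThan_iff)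
qed

end

section \<open>Summation over the iterations\<close>

theorem theorem4p2:
  fixes N K :: nat
    and p :: "('x::finite, 'a::finite) kernel"
    and \<mu>0 :: "real ^ ('x \<times> 'a)"
    and f :: "nat \<Rightarrow> real ^ ('x \<times> 'a) \<Rightarrow> real"
    and G :: "nat \<Rightarrow> real ^ ('x \<times> 'a) \<Rightarrow> real ^ ('x \<times> 'a)"
    and l L :: real
    and \<tau> :: "nat \<Rightarrow> real"
    and \<pi>0 \<pi>star :: "('x, 'a) policy"
  assumes "1 \<le> N" and "1 \<le> K"
    and "transition_kernel N p"
    and "\<mu>0 \<in> prob_simplex"
    and "\<And>n. n \<in> {1..N} \<Longrightarrow> convex_on prob_simplex (f n)"
    and "\<And>n. n \<in> {1..N} \<Longrightarrow> simplex_gradient (f n) (G n)"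
    and "\<And>n. n \<in> {1..N} \<Longrightarrow> lipschitz1_on l prob_simplex (f n)"
    and "is_arg_min (\<lambda>\<pi>. objective N f (occ p \<mu>0 \<pi>)) (\<lambda>\<pi>. \<pi> \<in> policies N) \<pi>star"
    and "\<pi>0 \<in> policies N"
    and "occ p \<mu>0 \<pi>0 \<in> occ_set_pos N p \<mu>0"
    and "L = l * real N"
    and "\<And>k. k < K \<Longrightarrow>
           \<tau> k = 1 / L * sqrt (2 * Gam N (occ p \<mu>0 \<pi>star) (occ p \<mu>0 \<pi>0) / real K)"
  shows "(MIN k\<in>{0..K}. objective N f (occ p \<mu>0 (md_curl N p \<mu>0 G \<tau> \<pi>0 k)))
           - objective N f (occ p \<mu>0 \<pi>star)
         \<le> L * sqrt (2 * Gam N (occ p \<mu>0 \<pi>star) (occ p \<mu>0 \<pi>0)) / sqrt (real K)"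
proof -
  interpret finite_horizon_mdp N p \<mu>0
    using assms(3,4) by unfold_locales
  define \<pi> where "\<pi> = md_curl N p \<mu>0 G \<tau> \<pi>0"
  define F where "F k = objective N f (occ p \<mu>0 (\<pi> k))" for k
  define Fs where "Fs = objective N f (occ p \<mu>0 \<pi>star)"
  define \<Gamma> where "\<Gamma> = Gam N (occ p \<mu>0 \<pi>star) (occ p \<mu>0 \<pi>0)"
  define M where "M = (MIN k\<in>{0..K}. F k)"
  have N: "0 < N" and K: "0 < K" using assms(1,2) by auto
  have star: "\<pi>star \<in> policies N"
    using assms(8) by (simp add: is_arg_min_def)
  have ex0: "exploring \<pi>0"
    by (rule exploring_if_occ_set_pos[OF assms(9,10)])
  have \<Gamma>: "\<Gamma> = log_ratio \<pi>star \<pi>star \<pi>0"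
    unfolding \<Gamma>_def by (rule Gam_occ[OF star assms(9) ex0])
  have \<Gamma>_nonneg: "0 \<le> \<Gamma>"
    unfolding \<Gamma> by (rule log_ratio_nonneg[OF star assms(9) ex0])
  have \<pi>: "\<pi> k \<in> policies N" "exploring (\<pi> k)" for k
    using md_curl_invariant[OF assms(9) ex0] by (auto simp: \<pi>_def)
  have l: "0 \<le> l"
    using assms(7)[of 1] N by (auto simp: lipschitz1_on_def)
  have M_le: "M \<le> F k" if "k \<le> K" for k
    unfolding M_def using that by (intro Min_le) auto
  \<comment> \<open>A direct Lipschitz bound on the initial gap, for the degenerate cases L = 0 or
    \<Gamma> = 0: there the learning rate is 0 (division by zero being 0), while
    \<open>md_step_descent\<close> requires a positive one.\<close>
  have F0: "F 0 - Fs \<le> L * norm_sup"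
    if bound: "\<And>n. n < N \<Longrightarrow> norm1 (occ p \<mu>0 \<pi>star (Suc n) - occ p \<mu>0 \<pi>0 (Suc n)) \<le> norm_sup" for norm_sup
  proof -
    have "f (Suc n) (occ p \<mu>0 \<pi>0 (Suc n)) - f (Suc n) (occ p \<mu>0 \<pi>star (Suc n)) \<le> l * norm_sup"
      if n: "n < N" for n
    proof -
      have "\<bar>f (Suc n) (occ p \<mu>0 \<pi>star (Suc n)) - f (Suc n) (occ p \<mu>0 \<pi>0 (Suc n))\<bar>
          \<le> l * norm1 (occ p \<mu>0 \<pi>star (Suc n) - occ p \<mu>0 \<pi>0 (Suc n))"
        using assms(7)[of "Suc n"] n occ_simplex[OF star, of "Suc n"] occ_simplex[OF assms(9), of "Suc n"]
        by (simp add: lipschitz1_on_def)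
      also have "\<dots> \<le> l * norm_sup"
        using l bound[OF n] by (intro mult_left_mono)
      finally show ?thesis by linarith
    qed
    then have "(\<Sum>n<N. f (Suc n) (occ p \<mu>0 \<pi>0 (Suc n)) - f (Suc n) (occ p \<mu>0 \<pi>star (Suc n)))
        \<le> (\<Sum>n<N. l * norm_sup)"
      by (intro sum_mono) auto
    then show ?thesis
      by (simp add: F_def Fs_def \<pi>_def objective_alt sum_subtractf assms(11) mult_ac)
  qed
  have "M - Fs \<le> L * sqrt (2 * \<Gamma>) / sqrt (real K)"
  proof (cases "L = 0 \<or> \<Gamma> = 0")
    case True
    have "F 0 - Fs \<le> 0"
    proof (cases "L = 0")
      case True
      \<comment> \<open>Any uniform bound on the distances will do, as it is multiplied by L =
        0.\<close>
      define c where "c = Max ((\<lambda>n. norm1 (occ p \<mu>0 \<pi>star (Suc n) - occ p \<mu>0 \<pi>0 (Suc n))) ` {..<N})"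
      have "F 0 - Fs \<le> L * c"
        unfolding c_def by (rule F0) (auto intro!: Max_ge)
      then show ?thesis using True by simp
    next
      case False
      with True have "log_ratio \<pi>star \<pi>star \<pi>0 = 0" using \<Gamma> by simp
      with occ_pinsker[OF star assms(9) ex0]
      have pinsker: "s * norm1 (occ p \<mu>0 \<pi>star n - occ p \<mu>0 \<pi>0 n) \<le> s\<^sup>2 / 2" if "n \<le> N" "0 \<le> s" for n s
        using that by auto
      have "norm1 (occ p \<mu>0 \<pi>star n - occ p \<mu>0 \<pi>0 n) \<le> 0" if n: "n \<le> N" for n
      \<comment> \<open>With zero divergence, taking s = e in \<open>pinsker\<close> and dividing by
        e bounds the distance by e / 2 for every positive e.\<close>
      proof (rule field_le_epsilon)
        fix e :: real assume e: "0 < e"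
        have "e * norm1 (occ p \<mu>0 \<pi>star n - occ p \<mu>0 \<pi>0 n) \<le> e * (e / 2)"
          using pinsker[OF n, of e] e by (simp add: power2_eq_square)
        then show "norm1 (occ p \<mu>0 \<pi>star n - occ p \<mu>0 \<pi>0 n) \<le> 0 + e"
          using e by simp
      qed
      then show ?thesis using F0[of 0] by simp
    qed
    then have "M - Fs \<le> 0" using M_le[of 0] by simp
    also have "0 \<le> L * sqrt (2 * \<Gamma>) / sqrt (real K)"
      using l \<Gamma>_nonneg by (simp add: assms(11))
    finally show ?thesis .
  next
    case False
    moreover have "0 \<le> L"
      using l by (simp add: assms(11))
    ultimately have L: "0 < L" and \<Gamma>_pos: "0 < \<Gamma>"
      using \<Gamma>_nonneg by linarith+
    \<comment> \<open>This rate makes the quadratic term of each iteration equal to \<Gamma> / K, so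
      that over K iterations it adds up to the initial divergence.\<close>
    define t where "t = 1 / L * sqrt (2 * \<Gamma> / real K)"
    have t: "0 < t" using L \<Gamma>_pos K by (simp add: t_def)
    have tL: "(t * L)\<^sup>2 = 2 * \<Gamma> / real K"
      using L \<Gamma>_pos by (simp add: t_def)
    have step: "t * (M - Fs) \<le> log_ratio \<pi>star \<pi>star (\<pi> k) - log_ratio \<pi>star \<pi>star (\<pi> (Suc k)) + \<Gamma> / real K"
      if k: "k < K" for k
    proof -
      have \<tau>: "\<tau> k = t"
        using assms(12)[OF k] by (simp add: t_def \<Gamma>_def)
      have "t * (M - Fs) \<le> t * (F k - Fs)"
        using M_le[of k] k t by simp
      also have "\<dots> \<le> log_ratio \<pi>star \<pi>star (\<pi> k) - log_ratio \<pi>star \<pi>star (md_step t G (\<pi> k))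
          + (t * (l * real N))\<^sup>2 / 2"
        unfolding F_def Fs_def
        by (rule md_step_descent[OF _ _ _ l N t \<pi> star]) (rule assms(5-7), assumption)+
      also have "md_step t G (\<pi> k) = \<pi> (Suc k)"
        by (simp only: \<pi>_def md_curl_Suc \<tau>)
      also have "(t * (l * real N))\<^sup>2 / 2 = \<Gamma> / real K"
        using tL by (simp add: assms(11))
      finally show ?thesis .
    qed
    have "real K * (t * (M - Fs)) = (\<Sum>k<K. t * (M - Fs))"
      by simp
    also have "\<dots> \<le> (\<Sum>k<K. log_ratio \<pi>star \<pi>star (\<pi> k) - log_ratio \<pi>star \<pi>star (\<pi> (Suc k)) + \<Gamma> / real K)"
      using step by (intro sum_mono) auto
    also have "\<dots> = \<Gamma> - log_ratio \<pi>star \<pi>star (\<pi> K) + \<Gamma>"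
    proof -
      have "\<pi> 0 = \<pi>0" by (simp add: \<pi>_def)
      then show ?thesis
        using K by (simp add: sum.distrib \<Gamma>
            sum_lessThan_telescope'[of "\<lambda>k. log_ratio \<pi>star \<pi>star (\<pi> k)"])
    qed
    also have "\<dots> \<le> 2 * \<Gamma>"
      using log_ratio_nonneg[OF star \<pi>] by simp
    also have "\<dots> = real K * (t * L)\<^sup>2"
      using K by (simp add: tL)
    \<comment> \<open>Exposes the common factor K t, which is cancelled next.\<close>
    also have "\<dots> = real K * (t * (t * L * L))"
      by (simp add: power2_eq_square mult_ac)
    finally have "M - Fs \<le> t * L * L"
      using K t by simp
    also have "\<dots> = L * sqrt (2 * \<Gamma>) / sqrt (real K)"
      using L by (simp add: t_def real_sqrt_divide)
    finally show ?thesis .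
  qed
  then show ?thesis
    by (simp add: M_def F_def Fs_def \<Gamma>_def \<pi>_def)
qed

end
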